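(* Let $L$ be a complete atomistic lattice. A binary operation $T_\diamond$ on $L$ is a left-semicontinuous t-norm on $L$ if and only if there exists a t-norm $T$ on $C(L)=A(L)\cup\{0,1\}$ such that $T_\diamond=\overline{T}$, where $\overline{T}(x,y)=\bigvee_{u\in\kappa(x)}\bigvee_{v\in\kappa(y)}T(u,v)$ with $\kappa(x)=\{u\in C(L)\setminus\{0\}\mid u\le x\}$, and $T$ satisfies: for every $S\subseteq L$ with $\bigvee S\ne 1$, $T(u,u)=0$ for every $u\in A(\bigvee S)\setminus\bigcup_{x\in S}A(x)$.
   Context: A lattice $L$ with bottom $0$ and top $1$ is atomistic if every element is a join of atoms (elements covering $0$); $A(L)$ is the set of atoms, $A(x)=\{a\in A(L)\mid a\le x\}$, and $C(L)=A(L)\cup\{0,1\}$ has the order inherited from $L$. A t-norm on a bounded poset with top $1$ is a binary operation that is monotone in each argument, commutative, associative, with neutral element $1$. A t-norm $T$ on a complete lattice $L$ is left-semicontinuous if $T(a,\bigvee S)=\bigvee_{x\in S}T(a,x)$ for every $a\in L$ and every $S\subseteq L$ with $\bigvee S\ne 1$. *)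

theory Defs
  imports Main
begin

definition atom :: "'a::order_bot \<Rightarrow> bool" where
  "atom a \<longleftrightarrow> bot < a \<and> \<not> (\<exists>z. bot < z \<and> z < a)"

definition atoms :: "'a::order_bot set" where
  "atoms = {a. atom a}"

definition atoms_below :: "'a::order_bot \<Rightarrow> 'a set" where
  "atoms_below x = {a \<in> atoms. a \<le> x}"

definition atomistic :: "'a::complete_lattice itself \<Rightarrow> bool" where
  "atomistic _ \<longleftrightarrow> (\<forall>x::'a. \<exists>S \<subseteq> atoms. x = Sup S)"

definition C_carrier :: "'a::{order_bot,order_top} set" where
  "C_carrier = atoms \<union> {bot, top}"

text \<open>
  A t-norm on the subposet \<open>P\<close>, ordered as in the ambient type; \<open>P\<close> is meant to contain
  \<open>bot\<close> and \<open>top\<close>. Only the values of \<open>T\<close> on \<open>P \<times> P\<close> matter.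
\<close>
definition tnorm_on :: "'a::{order_bot,order_top} set \<Rightarrow> ('a \<Rightarrow> 'a \<Rightarrow> 'a) \<Rightarrow> bool" where
  "tnorm_on P T \<longleftrightarrow>
     (\<forall>x\<in>P. \<forall>y\<in>P. T x y \<in> P) \<and>
     (\<forall>z\<in>P. mono_on P (\<lambda>x. T x z) \<and> mono_on P (\<lambda>x. T z x)) \<and>
     (\<forall>x\<in>P. \<forall>y\<in>P. T x y = T y x) \<and>
     (\<forall>x\<in>P. \<forall>y\<in>P. \<forall>z\<in>P. T (T x y) z = T x (T y z)) \<and>
     (\<forall>x\<in>P. T top x = x \<and> T x top = x)"

definition left_semicontinuous :: "('a::complete_lattice \<Rightarrow> 'a \<Rightarrow> 'a) \<Rightarrow> bool" where
  "left_semicontinuous T \<longleftrightarrow>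
     (\<forall>a S. Sup S \<noteq> top \<longrightarrow> T a (Sup S) = (SUP x\<in>S. T a x))"

definition kappa :: "'a::{order_bot,order_top} \<Rightarrow> 'a set" where
  "kappa x = {u \<in> C_carrier - {bot}. u \<le> x}"

definition tnorm_extension ::
  "('a::complete_lattice \<Rightarrow> 'a \<Rightarrow> 'a) \<Rightarrow> 'a \<Rightarrow> 'a \<Rightarrow> 'a" where
  "tnorm_extension T x y = (SUP u\<in>kappa x. SUP v\<in>kappa y. T u v)"

end

theory Submission
  imports Defs
begin

text \<open>
  Distinct atoms multiply to \<open>bot\<close>, so a t-norm on \<open>C(L)\<close> is determined by its set of idempotent
  atoms, and for \<open>x, y \<noteq> top\<close> the extension is the join of the idempotent atoms below both \<open>x\<close>
  and \<open>y\<close>. The condition on \<open>T\<close> says that an idempotent atom below a join different from \<open>top\<close>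
  lies below some member of the joined set. Away from \<open>top\<close>, mapping \<open>x\<close> to the set of idempotent
  atoms below \<open>x\<close> therefore turns the extension into intersection and joins into unions, which
  gives associativity and left-semicontinuity. Conversely, a left-semicontinuous t-norm is the
  extension of its restriction to \<open>C(L)\<close>.
\<close>

definition idem_below :: "('a::order_bot \<Rightarrow> 'a \<Rightarrow> 'a) \<Rightarrow> 'a \<Rightarrow> 'a set" where
  "idem_below T x = {u \<in> atoms_below x. T u u = u}"

definition idem_join_prime :: "('a::complete_lattice \<Rightarrow> 'a \<Rightarrow> 'a) \<Rightarrow> bool" where
  "idem_join_prime T \<longleftrightarrow>
     (\<forall>S :: 'a set. Sup S \<noteq> top \<longrightarrow>
          (\<forall>u \<in> atoms_below (Sup S) - (\<Union>x\<in>S. atoms_below x). T u u = bot))"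

section \<open>Atoms and t-norms on a subposet\<close>

lemma atom_le_cases: "atom u \<Longrightarrow> x \<le> u \<Longrightarrow> x = bot \<or> x = u"
  unfolding atom_def by (metis bot.not_eq_extremum order.not_eq_order_implies_strict)

lemma atom_not_bot: "atom u \<Longrightarrow> u \<noteq> bot"
  by (auto simp: atom_def)

lemma tnorm_on_commute: "tnorm_on P T \<Longrightarrow> x \<in> P \<Longrightarrow> y \<in> P \<Longrightarrow> T x y = T y x"
  unfolding tnorm_on_def by blast

lemma tnorm_on_top:
  assumes "tnorm_on P T" "x \<in> P"
  shows "T top x = x" "T x top = x"
  using assms unfolding tnorm_on_def by blast+

lemma tnorm_on_le:
  assumes "tnorm_on P T" "top \<in> P" "x \<in> P" "y \<in> P"
  shows "T x y \<le> x" "T x y \<le> y"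
proof -
  have "mono_on P (\<lambda>u. T u y)" "mono_on P (\<lambda>u. T x u)"
    using assms unfolding tnorm_on_def by blast+
  hence "T x y \<le> T x top" "T x y \<le> T top y"
    using assms by (auto intro: mono_onD)
  thus "T x y \<le> x" "T x y \<le> y"
    by (simp_all add: tnorm_on_top[OF assms(1)] assms)
qed

section \<open>Elements as joins of atoms and of \<open>kappa\<close>\<close>

lemma Sup_atoms_below:
  fixes x :: "'a::complete_lattice"
  assumes "atomistic TYPE('a)"
  shows "Sup (atoms_below x) = x"
proof (rule antisym)
  show "Sup (atoms_below x) \<le> x"
    by (rule Sup_least) (simp add: atoms_below_def)
  obtain S where "S \<subseteq> atoms" "x = Sup S"
    using assms unfolding atomistic_def by blast
  thus "x \<le> Sup (atoms_below x)"
    using Sup_subset_mono[of S "atoms_below x"] by (auto simp: atoms_below_def intro: Sup_upper)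
qed

lemma kappa_not_top:
  "x \<noteq> top \<Longrightarrow> kappa x = atoms_below x"
  by (auto simp: kappa_def C_carrier_def atoms_below_def atoms_def top_unique
      dest: atom_not_bot)

lemma Sup_kappa:
  fixes x :: "'a::complete_lattice"
  assumes "atomistic TYPE('a)"
  shows "Sup (kappa x) = x"
proof (rule antisym)
  show "Sup (kappa x) \<le> x"
    by (rule Sup_least) (simp add: kappa_def)
  have "atoms_below x \<subseteq> kappa x"
    by (auto simp: kappa_def C_carrier_def atoms_below_def atoms_def dest: atom_not_bot)
  thus "x \<le> Sup (kappa x)"
    using Sup_atoms_below[OF assms] Sup_subset_mono by metis
qed

lemma kappa_mono: "x \<le> y \<Longrightarrow> kappa x \<subseteq> kappa y"
  by (auto simp: kappa_def)

lemma kappa_subset: "kappa x \<subseteq> C_carrier"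
  by (auto simp: kappa_def)

lemma top_in_C: "top \<in> C_carrier"
  by (simp add: C_carrier_def)

section \<open>The extension: monotonicity, commutativity, neutral element, formula away from
  \<open>top\<close>\<close>

lemma tnorm_extension_mono:
  assumes "x \<le> x'" "y \<le> y'"
  shows "tnorm_extension T x y \<le> tnorm_extension T x' y'"
  unfolding tnorm_extension_def
  by (intro SUP_subset_mono kappa_mono assms order_refl)

lemma tnorm_extension_commute:
  assumes "tnorm_on C_carrier T"
  shows "tnorm_extension T x y = tnorm_extension T y x"
proof -
  have "T u v = T v u" if "u \<in> kappa a" "v \<in> kappa b" for u v a b
    using tnorm_on_commute[OF assms] that kappa_subset by blast
  hence "(SUP u\<in>kappa x. SUP v\<in>kappa y. T u v) = (SUP u\<in>kappa x. SUP v\<in>kappa y. T v u)"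
    by (intro SUP_cong) auto
  also have "\<dots> = (SUP v\<in>kappa y. SUP u\<in>kappa x. T v u)"
    by (rule SUP_commute)
  finally show ?thesis
    by (simp add: tnorm_extension_def)
qed

lemma tnorm_extension_top:
  fixes T :: "'a::complete_lattice \<Rightarrow> 'a \<Rightarrow> 'a"
  assumes "atomistic TYPE('a)" "tnorm_on C_carrier T"
  shows "tnorm_extension T top y = y"
proof (rule antisym)
  have "T u v \<le> y" if "u \<in> kappa top" "v \<in> kappa y" for u v
  proof -
    have "T u v \<le> v"
      using tnorm_on_le(2)[OF assms(2) top_in_C] that kappa_subset by blast
    also have "v \<le> y"
      using that by (simp add: kappa_def)
    finally show ?thesis .
  qed
  thus "tnorm_extension T top y \<le> y"
    unfolding tnorm_extension_def by (intro SUP_least)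
  show "y \<le> tnorm_extension T top y"
  proof (cases "(top::'a) = bot")
    \<comment> \<open>In the one-element lattice \<open>kappa top\<close> is empty, so
      \<open>top\<close> cannot serve as an index there.\<close>
    case True
    thus ?thesis
      by (metis bot_least top_greatest order_trans)
  next
    case False
    hence top: "(top::'a) \<in> kappa top"
      by (simp add: kappa_def top_in_C)
    \<comment> \<open>The single index \<open>u = top\<close> already contributes all of
      \<open>y\<close> to the outer join.\<close>
    have "T top v = v" if "v \<in> kappa y" for v
      using tnorm_on_top(1)[OF assms(2)] that kappa_subset by blast
    hence "(SUP v\<in>kappa y. T top v) = y"
      using Sup_kappa[OF assms(1)] by simp
    thus ?thesis
      unfolding tnorm_extension_def using SUP_upper[OF top, of "\<lambda>u. SUP v\<in>kappa y. T u v"]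
      by simp
  qed
qed

text \<open>Away from \<open>top\<close>, \<open>kappa\<close> consists of atoms. A product of atoms
  \<open>u\<close> and \<open>v\<close> lies below both, so if it is not \<open>bot\<close> it
  equals both; then \<open>u = v\<close> is idempotent and only these diagonal terms survive in the
  double join.\<close>

lemma tnorm_extension_not_top:
  fixes T :: "'a::complete_lattice \<Rightarrow> 'a \<Rightarrow> 'a"
  assumes T: "tnorm_on C_carrier T" and xy: "x \<noteq> top" "y \<noteq> top"
  shows "tnorm_extension T x y = Sup (idem_below T x \<inter> idem_below T y)"
proof (rule antisym)
  have "T u v \<le> Sup (idem_below T x \<inter> idem_below T y)"
    if uv: "u \<in> atoms_below x" "v \<in> atoms_below y" for u v
  proof (cases "T u v = bot")
    case False
    have at: "atom u" "atom v" and C: "u \<in> C_carrier" "v \<in> C_carrier"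
      using uv by (auto simp: atoms_below_def atoms_def C_carrier_def)
    have "T u v = u" "T u v = v"
      using False tnorm_on_le[OF T top_in_C C] at atom_le_cases by blast+
    with uv show ?thesis
      by (auto simp: idem_below_def intro!: Sup_upper)
  qed simp
  thus "tnorm_extension T x y \<le> Sup (idem_below T x \<inter> idem_below T y)"
    unfolding tnorm_extension_def kappa_not_top[OF xy(1)] kappa_not_top[OF xy(2)]
    by (intro SUP_least)
  show "Sup (idem_below T x \<inter> idem_below T y) \<le> tnorm_extension T x y"
    unfolding tnorm_extension_def kappa_not_top[OF xy(1)] kappa_not_top[OF xy(2)]
  proof (rule Sup_least)
    fix u
    assume u: "u \<in> idem_below T x \<inter> idem_below T y"
    hence "T u u \<le> (SUP u\<in>atoms_below x. SUP v\<in>atoms_below y. T u v)"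
      by (intro SUP_upper2[of u "atoms_below x"] SUP_upper) (auto simp: idem_below_def)
    thus "u \<le> (SUP u\<in>atoms_below x. SUP v\<in>atoms_below y. T u v)"
      using u by (simp add: idem_below_def)
  qed
qed

section \<open>Idempotent atoms below joins and products\<close>

lemma idem_below_mono: "x \<le> y \<Longrightarrow> idem_below T x \<subseteq> idem_below T y"
  by (auto simp: idem_below_def atoms_below_def)

text \<open>The condition on \<open>T\<close> enters here: an idempotent atom below
  \<open>Sup S\<close> but below no member of \<open>S\<close> would satisfy both
  \<open>T u u = u\<close> and \<open>T u u = bot\<close>, although atoms are not
  \<open>bot\<close>.\<close>

lemma idem_below_Sup:
  assumes "idem_join_prime T" "Sup S \<noteq> top"
  shows "idem_below T (Sup S) = (\<Union>x\<in>S. idem_below T x)"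
proof
  show "(\<Union>x\<in>S. idem_below T x) \<subseteq> idem_below T (Sup S)"
    by (intro UN_least idem_below_mono Sup_upper)
  show "idem_below T (Sup S) \<subseteq> (\<Union>x\<in>S. idem_below T x)"
  proof
    fix u
    assume u: "u \<in> idem_below T (Sup S)"
    hence "u \<noteq> bot"
      by (auto simp: idem_below_def atoms_below_def atoms_def dest: atom_not_bot)
    with u assms have "u \<in> (\<Union>x\<in>S. atoms_below x)"
      unfolding idem_join_prime_def idem_below_def by force
    with u show "u \<in> (\<Union>x\<in>S. idem_below T x)"
      by (auto simp: idem_below_def)
  qed
qed

text \<open>Instance \<open>S = Q\<close> of the previous lemma, since the only atom below an atom
  is that atom itself. It makes a set of idempotent atoms recoverable from its join.\<close>

lemma idem_below_Sup_idem:
  assumes "idem_join_prime T" "Sup Q \<noteq> top" and Q: "Q \<subseteq> idem_below T x"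
  shows "idem_below T (Sup Q) = Q"
proof -
  have "idem_below T u = {u}" if "u \<in> Q" for u
    using that Q atom_le_cases atom_not_bot
    by (fastforce simp: idem_below_def atoms_below_def atoms_def)
  thus ?thesis
    using idem_below_Sup[OF assms(1,2)] by simp
qed

lemma tnorm_extension_le_left:
  fixes T :: "'a::complete_lattice \<Rightarrow> 'a \<Rightarrow> 'a"
  assumes "atomistic TYPE('a)" "tnorm_on C_carrier T"
  shows "tnorm_extension T x y \<le> x"
proof -
  have "tnorm_extension T x y \<le> tnorm_extension T x top"
    by (intro tnorm_extension_mono order_refl top_greatest)
  also have "\<dots> = x"
    using tnorm_extension_commute[OF assms(2), of x top] tnorm_extension_top[OF assms] by simp
  finally show ?thesis .
qed

text \<open>Makes iterated products computable: the product stays away from \<open>top\<close>, so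
  the formula by idempotent atoms applies to it again.\<close>

lemma idem_below_tnorm_extension:
  fixes T :: "'a::complete_lattice \<Rightarrow> 'a \<Rightarrow> 'a"
  assumes "atomistic TYPE('a)" "tnorm_on C_carrier T" "idem_join_prime T"
    and "x \<noteq> top" "y \<noteq> top"
  shows "tnorm_extension T x y \<noteq> top"
    and "idem_below T (tnorm_extension T x y) = idem_below T x \<inter> idem_below T y"
proof -
  show *: "tnorm_extension T x y \<noteq> top"
    using tnorm_extension_le_left[OF assms(1,2), of x y] assms(4) by (auto simp: top_unique)
  show "idem_below T (tnorm_extension T x y) = idem_below T x \<inter> idem_below T y"
    using * unfolding tnorm_extension_not_top[OF assms(2,4,5)]
    by (rule idem_below_Sup_idem[OF assms(3) _ Int_lower1])
qed

section \<open>Associativity and left-semicontinuity of the extension\<close>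

lemma tnorm_extension_assoc:
  fixes T :: "'a::complete_lattice \<Rightarrow> 'a \<Rightarrow> 'a"
  assumes "atomistic TYPE('a)" "tnorm_on C_carrier T" "idem_join_prime T"
  shows "tnorm_extension T (tnorm_extension T x y) z = tnorm_extension T x (tnorm_extension T y z)"
proof -
  have right: "tnorm_extension T a top = a" for a
    using tnorm_extension_commute[OF assms(2)] tnorm_extension_top[OF assms(1,2)] by metis
  show ?thesis
  proof (cases "x = top \<or> y = top \<or> z = top")
    case True
    thus ?thesis
      using right tnorm_extension_top[OF assms(1,2)] by auto
  next
    case False
    hence xyz: "x \<noteq> top" "y \<noteq> top" "z \<noteq> top"
      by auto
    \<comment> \<open>Both sides become the join of the idempotent atoms below all of
      \<open>x\<close>, \<open>y\<close> and \<open>z\<close>; only the bracketing of the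
      intersections differs.\<close>
    note ext = idem_below_tnorm_extension[OF assms]
    show ?thesis
      unfolding tnorm_extension_not_top[OF assms(2) ext(1)[OF xyz(1,2)] xyz(3)]
        tnorm_extension_not_top[OF assms(2) xyz(1) ext(1)[OF xyz(2,3)]]
        ext(2)[OF xyz(1,2)] ext(2)[OF xyz(2,3)] Int_assoc ..
  qed
qed

lemma left_semicontinuous_tnorm_extension:
  fixes T :: "'a::complete_lattice \<Rightarrow> 'a \<Rightarrow> 'a"
  assumes "atomistic TYPE('a)" "tnorm_on C_carrier T" "idem_join_prime T"
  shows "left_semicontinuous (tnorm_extension T)"
  unfolding left_semicontinuous_def
proof (intro allI impI)
  fix a :: 'a and S :: "'a set"
  assume S: "Sup S \<noteq> top"
  have not_top: "x \<noteq> top" if "x \<in> S" for x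
    using S that Sup_upper[OF that] by (auto simp: top_unique)
  show "tnorm_extension T a (Sup S) = (SUP x\<in>S. tnorm_extension T a x)"
  proof (cases "a = top")
    case True
    thus ?thesis
      by (simp add: tnorm_extension_top[OF assms(1,2)])
  next
    case False
    have "(SUP x\<in>S. tnorm_extension T a x) = (SUP x\<in>S. Sup (idem_below T a \<inter> idem_below T x))"
      using False not_top by (intro SUP_cong) (auto simp: tnorm_extension_not_top[OF assms(2)])
    also have "\<dots> = Sup (\<Union>x\<in>S. idem_below T a \<inter> idem_below T x)"
      using SUP_UNION[of "\<lambda>u. u" "\<lambda>x. idem_below T a \<inter> idem_below T x" S] by simp
    \<comment> \<open>Intersection distributes over unions of sets of atoms, whereas meets in the
      lattice may fail to distribute over joins.\<close>
    also have "(\<Union>x\<in>S. idem_below T a \<inter> idem_below T x) = idem_below T a \<inter> idem_below T (Sup S)"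
      by (simp add: idem_below_Sup[OF assms(3) S])
    finally show ?thesis
      using False S by (simp add: tnorm_extension_not_top[OF assms(2)])
  qed
qed

lemma tnorm_on_tnorm_extension:
  fixes T :: "'a::complete_lattice \<Rightarrow> 'a \<Rightarrow> 'a"
  assumes "atomistic TYPE('a)" "tnorm_on C_carrier T" "idem_join_prime T"
  shows "tnorm_on UNIV (tnorm_extension T)"
proof -
  have "tnorm_extension T a top = a" for a
    using tnorm_extension_commute[OF assms(2)] tnorm_extension_top[OF assms(1,2)] by metis
  thus ?thesis
    unfolding tnorm_on_def
    by (intro conjI ballI mono_onI UNIV_I tnorm_extension_mono tnorm_extension_top
        tnorm_extension_commute tnorm_extension_assoc assms order_refl)
qed

section \<open>From a left-semicontinuous t-norm back to \<open>C_carrier\<close>\<close>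

lemma tnorm_on_C_carrier_if_UNIV:
  assumes T: "tnorm_on UNIV T"
  shows "tnorm_on C_carrier T"
proof -
  have mono: "mono_on UNIV (\<lambda>x. T x z)" "mono_on UNIV (\<lambda>x. T z x)"
    and assoc: "T (T x y) z = T x (T y z)" for x y z
    using T unfolding tnorm_on_def by blast+
  \<comment> \<open>A product lies below its first factor; if that factor is an atom or
    \<open>bot\<close>, everything below it is again in \<open>C_carrier\<close>, and the factor
    \<open>top\<close> is neutral.\<close>
  have closed: "T x y \<in> C_carrier" if "x \<in> C_carrier" "y \<in> C_carrier" for x y
  proof (cases "x = top")
    case True
    thus ?thesis
      using that(2) by (simp add: tnorm_on_top[OF T])
  next
    case False
    hence "atom x \<or> x = bot"
      using that(1) by (auto simp: C_carrier_def atoms_def)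
    hence "T x y = bot \<or> T x y = x"
      using tnorm_on_le(1)[OF T UNIV_I UNIV_I UNIV_I, of x y] atom_le_cases bot_unique by metis
    thus ?thesis
      using that(1) by (elim disjE) (simp_all add: C_carrier_def)
  qed
  show ?thesis
    unfolding tnorm_on_def
    by (intro conjI ballI closed assoc mono[THEN mono_on_subset] subset_UNIV
        tnorm_on_commute[OF T] tnorm_on_top[OF T] UNIV_I)
qed

lemma tnorm_extension_restrict:
  fixes T :: "'a::complete_lattice \<Rightarrow> 'a \<Rightarrow> 'a"
  assumes at: "atomistic TYPE('a)" and T: "tnorm_on UNIV T" and lsc: "left_semicontinuous T"
  shows "tnorm_extension T = T"
proof (intro ext)
  fix x y :: 'a
  note TC = tnorm_on_C_carrier_if_UNIV[OF T]
  note comm = tnorm_on_commute[OF T UNIV_I UNIV_I] and top = tnorm_on_top(1)[OF T UNIV_I]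
  show "tnorm_extension T x y = T x y"
  proof (cases "x = top \<or> y = top")
    case True
    thus ?thesis
      using tnorm_extension_commute[OF TC] tnorm_extension_top[OF at TC] comm top by metis
  next
    case False
    \<comment> \<open>Left-semicontinuity with \<open>S = kappa b\<close>, whose join is
      \<open>b\<close> and hence not \<open>top\<close>.\<close>
    have Sup_right: "T a b = (SUP v\<in>kappa b. T a v)" if "b \<noteq> top" for a b
      using lsc that Sup_kappa[OF at] unfolding left_semicontinuous_def by metis
    \<comment> \<open>Left-semicontinuity expands the second argument only, so commutativity moves
      \<open>x\<close> there first.\<close>
    have "T x y = T y x"
      by (rule comm)
    also have "\<dots> = (SUP u\<in>kappa x. T y u)"
      using Sup_right False by blast
    also have "\<dots> = (SUP u\<in>kappa x. T u y)"
      by (intro SUP_cong comm refl)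
    also have "\<dots> = (SUP u\<in>kappa x. SUP v\<in>kappa y. T u v)"
      using Sup_right[of y] False by simp
    finally show ?thesis
      by (simp add: tnorm_extension_def)
  qed
qed

text \<open>If the atom \<open>u\<close> is not below \<open>x\<close>, then \<open>T u x\<close>,
  being below both, is \<open>bot\<close>. When this holds for all members of \<open>S\<close>,
  left-semicontinuity gives \<open>T u (Sup S) = bot\<close>, and \<open>T u u\<close> lies below
  this by monotonicity.\<close>

lemma idem_join_prime_if_left_semicontinuous:
  fixes T :: "'a::complete_lattice \<Rightarrow> 'a \<Rightarrow> 'a"
  assumes T: "tnorm_on UNIV T" and lsc: "left_semicontinuous T"
  shows "idem_join_prime T"
  unfolding idem_join_prime_def
proof (intro allI impI ballI)
  fix S :: "'a set" and u
  assume S: "Sup S \<noteq> top" and u: "u \<in> atoms_below (Sup S) - (\<Union>x\<in>S. atoms_below x)"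
  have "T u x = bot" if "x \<in> S" for x
  proof -
    have "atom u" "\<not> u \<le> x"
      using u that by (auto simp: atoms_below_def atoms_def)
    moreover have "T u x \<le> u" "T u x \<le> x"
      using tnorm_on_le[OF T] by blast+
    ultimately show ?thesis
      using atom_le_cases by metis
  qed
  hence "T u (Sup S) = bot"
    using lsc S by (simp add: left_semicontinuous_def)
  moreover have "T u u \<le> T u (Sup S)"
  proof (rule mono_onD[of UNIV "T u"])
    show "mono_on UNIV (T u)"
      using T unfolding tnorm_on_def by blast
    show "u \<le> Sup S"
      using u by (simp add: atoms_below_def)
  qed simp_all
  ultimately show "T u u = bot"
    by (simp add: bot_unique)
qed

theorem theorem4p3:
  fixes T_diamond :: "'a::complete_lattice \<Rightarrow> 'a \<Rightarrow> 'a"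
  assumes "atomistic TYPE('a)"
  shows "(tnorm_on UNIV T_diamond \<and> left_semicontinuous T_diamond) \<longleftrightarrow>
    (\<exists>T :: 'a \<Rightarrow> 'a \<Rightarrow> 'a.
       tnorm_on C_carrier T \<and>
       T_diamond = tnorm_extension T \<and>
       (\<forall>S :: 'a set. Sup S \<noteq> top \<longrightarrow>
          (\<forall>u \<in> atoms_below (Sup S) - (\<Union>x\<in>S. atoms_below x). T u u = bot)))"
proof -
  have "(tnorm_on UNIV T_diamond \<and> left_semicontinuous T_diamond) \<longleftrightarrow>
    (\<exists>T. tnorm_on C_carrier T \<and> T_diamond = tnorm_extension T \<and> idem_join_prime T)"
  proof
    assume "tnorm_on UNIV T_diamond \<and> left_semicontinuous T_diamond"
    hence T: "tnorm_on UNIV T_diamond" "left_semicontinuous T_diamond"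
      by simp_all
    \<comment> \<open>The witness is \<open>T_diamond\<close> itself: all three conditions look only
      at its values on \<open>C_carrier\<close>, so it serves as its own restriction.\<close>
    show "\<exists>T. tnorm_on C_carrier T \<and> T_diamond = tnorm_extension T \<and> idem_join_prime T"
      using tnorm_on_C_carrier_if_UNIV[OF T(1)] tnorm_extension_restrict[OF assms T, symmetric]
        idem_join_prime_if_left_semicontinuous[OF T] by blast
  next
    assume "\<exists>T. tnorm_on C_carrier T \<and> T_diamond = tnorm_extension T \<and> idem_join_prime T"
    then obtain T where T: "tnorm_on C_carrier T" "idem_join_prime T"
      and eq: "T_diamond = tnorm_extension T"
      by blast
    show "tnorm_on UNIV T_diamond \<and> left_semicontinuous T_diamond"
      unfolding eq
      using tnorm_on_tnorm_extension[OF assms T] left_semicontinuous_tnorm_extension[OF assms T] ..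
  qed
  thus ?thesis
    unfolding idem_join_prime_def .
qed

end
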